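(* Suppose that a map $T:A(\bar{\mathbb D})\to A(\bar{\mathbb D})$ is 2-local in $\operatorname{Iso}(A(\bar{\mathbb D}),A(\bar{\mathbb D}))$. Then $T\in \operatorname{Iso}(A(\bar{\mathbb D}),A(\bar{\mathbb D}))$.
   Context: $\mathbb D$ is the open unit disk and $\bar{\mathbb D}$ the closed unit disk in $\mathbb C$. $A(\bar{\mathbb D})$ is the disk algebra: the algebra of all complex-valued continuous functions on $\bar{\mathbb D}$ which are analytic on $\mathbb D$, with the supremum norm. For normed spaces $\mathfrak{M}_1,\mathfrak{M}_2$, $\operatorname{Iso}(\mathfrak{M}_1,\mathfrak{M}_2)$ is the set of all surjective isometries (distance preserving maps, not necessarily linear) from $\mathfrak{M}_1$ onto $\mathfrak{M}_2$. A map $T:\mathfrak{M}_1\to\mathfrak{M}_2$ (no linearity, continuity or surjectivity assumed) is 2-local in $\operatorname{Iso}(\mathfrak{M}_1,\mathfrak{M}_2)$ if for every $x,y\in\mathfrak{M}_1$ there is $T_{x,y}\in\operatorname{Iso}(\mathfrak{M}_1,\mathfrak{M}_2)$ such that $T(x)=T_{x,y}(x)$ and $T(y)=T_{x,y}(y)$. *)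

theory Defs
  imports "HOL-Analysis.Analysis"
begin

section \<open>The disk algebra\<close>

text \<open>A function on the closed unit disk is encoded as a function on all of the complex plane
  that vanishes off the disk, so that equality of representatives is equality on the disk.
  The last conjunct carries no other content: neither continuity on the closed disk nor
  analyticity on the open disk depends on values outside the closed disk.\<close>

typedef disk_algebra =
  "{f :: complex \<Rightarrow> complex. continuous_on (cball 0 1) f \<and> f analytic_on ball 0 1 \<and>
     (\<forall>z. z \<notin> cball 0 1 \<longrightarrow> f z = 0)}"
  morphisms disk_fun Abs_disk_algebra
proof -
  have "(\<lambda>_. 0) analytic_on ball (0::complex) 1"
    by (rule analytic_on_const)
  then show ?thesis
    by (intro exI[of _ "\<lambda>_. 0"]) auto
qed

setup_lifting type_definition_disk_algebra

lemma disk_algebra_eqI: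
  assumes "\<And>z. z \<in> cball 0 1 \<Longrightarrow> disk_fun f z = disk_fun g z"
  shows "f = g"
proof -
  have "disk_fun f = disk_fun g"
    using assms disk_fun[of f] disk_fun[of g] by fastforce
  then show ?thesis
    by (simp add: disk_fun_inject)
qed

lemma continuous_on_disk_fun: "continuous_on (cball 0 1) (disk_fun f)"
  using disk_fun[of f] by blast

lemma disk_fun_bdd: "bdd_above ((\<lambda>z. norm (disk_fun f z)) ` cball 0 1)"
  by (intro compact_imp_bounded[THEN bounded_imp_bdd_above] compact_continuous_image
      continuous_on_norm continuous_on_disk_fun compact_cball)

lemma analytic_on_disk_one: "(\<lambda>z. if z \<in> cball 0 1 then 1 else 0) analytic_on ball (0::complex) 1"
proof -
  have "(\<lambda>_. 1) holomorphic_on ball (0::complex) 1"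
    by (rule holomorphic_on_const)
  then have "(\<lambda>z. if z \<in> cball 0 1 then 1 else 0) holomorphic_on ball (0::complex) 1"
    by (rule holomorphic_transform) auto
  then show ?thesis
    by (simp add: analytic_on_open)
qed

lemma continuous_on_disk_one:
  "continuous_on (cball (0::complex) 1) (\<lambda>z. if z \<in> cball 0 1 then 1 else 0 :: complex)"
  by (rule continuous_on_eq[OF continuous_on_const[of _ 1]]) auto

text \<open>The norm is the supremum norm over the closed disk, and the metric and the topology are
  the ones it induces.\<close>

instantiation disk_algebra :: real_normed_algebra_1
begin

lift_definition zero_disk_algebra :: disk_algebra is "\<lambda>_. 0"
  by (auto intro: analytic_on_const)

lift_definition one_disk_algebra :: disk_algebra is "\<lambda>z. if z \<in> cball 0 1 then 1 else 0"
  using analytic_on_disk_one continuous_on_disk_one by auto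

lift_definition plus_disk_algebra :: "disk_algebra \<Rightarrow> disk_algebra \<Rightarrow> disk_algebra"
  is "\<lambda>f g z. f z + g z"
  by (auto intro: analytic_on_add continuous_on_add)

lift_definition minus_disk_algebra :: "disk_algebra \<Rightarrow> disk_algebra \<Rightarrow> disk_algebra"
  is "\<lambda>f g z. f z - g z"
  by (auto intro: analytic_on_diff continuous_on_diff)

lift_definition uminus_disk_algebra :: "disk_algebra \<Rightarrow> disk_algebra"
  is "\<lambda>f z. - f z"
  by (auto intro: analytic_on_neg continuous_on_minus)

lift_definition times_disk_algebra :: "disk_algebra \<Rightarrow> disk_algebra \<Rightarrow> disk_algebra"
  is "\<lambda>f g z. f z * g z"
  by (auto intro: analytic_on_mult continuous_on_mult)

lift_definition scaleR_disk_algebra :: "real \<Rightarrow> disk_algebra \<Rightarrow> disk_algebra"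
  is "\<lambda>r f z. r *\<^sub>R f z"
  by (auto simp: scaleR_conv_of_real
      intro: analytic_on_mult analytic_on_const continuous_on_mult continuous_on_const)

definition norm_disk_algebra :: "disk_algebra \<Rightarrow> real"
  where "norm_disk_algebra f = (SUP z\<in>cball 0 1. cmod (disk_fun f z))"

definition dist_disk_algebra :: "disk_algebra \<Rightarrow> disk_algebra \<Rightarrow> real"
  where "dist_disk_algebra f g = norm (f - g)"

definition sgn_disk_algebra :: "disk_algebra \<Rightarrow> disk_algebra"
  where "sgn_disk_algebra f = inverse (norm f) *\<^sub>R f"

definition uniformity_disk_algebra :: "(disk_algebra \<times> disk_algebra) filter"
  where "uniformity_disk_algebra = (INF e\<in>{0<..}. principal {(x, y). dist x y < e})"

definition open_disk_algebra :: "disk_algebra set \<Rightarrow> bool"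
  where "open_disk_algebra U = (\<forall>x\<in>U. \<forall>\<^sub>F (x', y) in uniformity. x' = x \<longrightarrow> y \<in> U)"

lemma norm_disk_fun_le: "z \<in> cball 0 1 \<Longrightarrow> cmod (disk_fun f z) \<le> norm f"
  unfolding norm_disk_algebra_def by (rule cSUP_upper[OF _ disk_fun_bdd])

lemma norm_disk_algebra_leI:
  "(\<And>z. z \<in> cball 0 1 \<Longrightarrow> cmod (disk_fun f z) \<le> B) \<Longrightarrow> norm f \<le> B"
  unfolding norm_disk_algebra_def by (rule cSUP_least) auto

lemma norm_disk_algebra_nonneg: "0 \<le> norm (f :: disk_algebra)"
  using norm_disk_fun_le[of 0 f] norm_ge_zero[of "disk_fun f 0"] by (simp del: norm_ge_zero)

instance
proof
  fix f g h :: disk_algebra and a b :: real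
  show "f + g + h = f + (g + h)" "f + g = g + f" "0 + f = f" "- f + f = 0" "f - g = f + - g"
    "a *\<^sub>R (f + g) = a *\<^sub>R f + a *\<^sub>R g" "(a + b) *\<^sub>R f = a *\<^sub>R f + b *\<^sub>R f"
    "a *\<^sub>R b *\<^sub>R f = (a * b) *\<^sub>R f" "1 *\<^sub>R f = f" "f * g * h = f * (g * h)"
    "(f + g) * h = f * h + g * h" "f * (g + h) = f * g + f * h"
    "a *\<^sub>R f * g = a *\<^sub>R (f * g)" "f * a *\<^sub>R g = a *\<^sub>R (f * g)"
    by (transfer; simp add: fun_eq_iff algebra_simps)+
  show "1 * f = f" "f * 1 = f"
    by (transfer; fastforce)+
  have "disk_fun 0 0 \<noteq> disk_fun 1 0"
    by (simp add: zero_disk_algebra.rep_eq one_disk_algebra.rep_eq)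
  then show "(0::disk_algebra) \<noteq> 1"
    by metis
  show "dist f g = norm (f - g)" "sgn f = inverse (norm f) *\<^sub>R f"
    by (simp_all add: dist_disk_algebra_def sgn_disk_algebra_def)
  show "(uniformity :: (disk_algebra \<times> disk_algebra) filter) =
      (INF e\<in>{0<..}. principal {(x, y). dist x y < e})"
    by (rule uniformity_disk_algebra_def)
  show "open U = (\<forall>x\<in>U. \<forall>\<^sub>F (x', y) in uniformity. x' = x \<longrightarrow> y \<in> U)"
    for U :: "disk_algebra set"
    by (rule open_disk_algebra_def)
  show "norm f = 0 \<longleftrightarrow> f = 0"
  proof
    assume *: "norm f = 0"
    show "f = 0"
    proof (rule disk_algebra_eqI)
      fix z :: complex
      assume "z \<in> cball 0 1"
      from norm_disk_fun_le[OF this, of f] * show "disk_fun f z = disk_fun 0 z"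
        by (simp add: zero_disk_algebra.rep_eq)
    qed
  next
    assume *: "f = 0"
    have "norm f \<le> 0"
      by (rule norm_disk_algebra_leI) (simp add: * zero_disk_algebra.rep_eq)
    with norm_disk_algebra_nonneg[of f] show "norm f = 0"
      by linarith
  qed
  show "norm (f + g) \<le> norm f + norm g"
    by (rule norm_disk_algebra_leI)
      (auto simp: plus_disk_algebra.rep_eq intro!: norm_triangle_mono norm_disk_fun_le)
  show "norm (f * g) \<le> norm f * norm g"
    by (rule norm_disk_algebra_leI)
      (auto simp: times_disk_algebra.rep_eq norm_mult
        intro!: mult_mono norm_disk_fun_le norm_disk_algebra_nonneg)
  have le: "norm (c *\<^sub>R k) \<le> \<bar>c\<bar> * norm k" for c and k :: disk_algebra
    by (rule norm_disk_algebra_leI)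
      (auto simp: scaleR_disk_algebra.rep_eq intro!: mult_left_mono norm_disk_fun_le)
  show "norm (a *\<^sub>R f) = \<bar>a\<bar> * norm f"
  proof (cases "a = 0")
    case True
    then show ?thesis
      using le[of a f] norm_disk_algebra_nonneg[of "a *\<^sub>R f"] by simp
  next
    case False
    have "inverse a *\<^sub>R a *\<^sub>R f = f"
      using False by transfer simp
    then have "norm f \<le> \<bar>inverse a\<bar> * norm (a *\<^sub>R f)"
      using le[of "inverse a" "a *\<^sub>R f"] by simp
    then have "\<bar>a\<bar> * norm f \<le> norm (a *\<^sub>R f)"
      using False by (simp add: field_simps)
    with le[of a f] show ?thesis
      by linarith
  qed
  show "norm (1 :: disk_algebra) = 1"
  proof (rule antisym)
    show "norm (1 :: disk_algebra) \<le> 1"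
      by (rule norm_disk_algebra_leI) (simp add: one_disk_algebra.rep_eq)
    show "1 \<le> norm (1 :: disk_algebra)"
      using norm_disk_fun_le[of 0 1] by (simp add: one_disk_algebra.rep_eq)
  qed
qed

end

instance disk_algebra :: comm_ring_1
proof
  fix f g :: disk_algebra
  show "f * g = g * f"
    by transfer (simp add: mult.commute)
qed (simp_all add: algebra_simps)


section \<open>Surjective isometries and 2-local maps\<close>

definition Iso :: "('a::real_normed_vector \<Rightarrow> 'b::real_normed_vector) set"
  where "Iso = {U. surj U \<and> (\<forall>x y. dist (U x) (U y) = dist x y)}"

definition two_local_in_Iso :: "('a::real_normed_vector \<Rightarrow> 'b::real_normed_vector) \<Rightarrow> bool"
  where "two_local_in_Iso T \<longleftrightarrow> (\<forall>x y. \<exists>U\<in>Iso. T x = U x \<and> T y = U y)"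

end

(* A 2-local map T preserves distances, so only surjectivity is at stake. Let S be the unit circle
   and, for |p| = |w| = 1, let u be the function w (1 + p^* z) / 2, which peaks at p. Since
   ||n u - f|| = n - Re (w^* f(p)) + o(1) as n grows, and T (n u) has norm n attained on S,
   compactness yields |b| = |q| = 1 with Re (w^* f(p)) <= Re (b^* (T f)(q)) for all f, whenever
   T 0 = 0.

   For a surjective isometry L fixing 0 this inequality, used for L and for its inverse, becomes an
   equality, and L f = a (f o tau) on S for all f, or L f = a (f o tau)^* on S for all f. The constant
   a arises because B = L 1 satisfies B L(f^2) = (L f)^2, so that it has no zeros, while |B| = 1 on S.
   No appeal to the Mazur-Ulam theorem is needed.

   After normalization T fixes all constants, hence b = w. Put psi = T z. Comparing the values of T at
   z, -z, iz, -iz pairwise through surjective isometries gives T(-z) = -psi and T(iz) = s psi,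
   T(-iz) = -s psi on S with s = i or s = -i. Testing the inequality on these four functions
   identifies q, and opposite inequalities combine to equalities. For s = i they say that
   T f = f o psi on S. For s = -i, the function z^3 would make psi invertible in the algebra, hence
   constant. Finally psi is a tau or a tau^* for some isometry L as above, which gives surjectivity. *)

theory Submission
  imports Defs "HOL-Complex_Analysis.Conformal_Mappings" "HOL-Real_Asymp.Real_Asymp"
begin

section \<open>Elements of the disk algebra and their boundary values\<close>

definition disk_of :: "(complex \<Rightarrow> complex) \<Rightarrow> disk_algebra"
  where "disk_of h = Abs_disk_algebra (\<lambda>z. if z \<in> cball 0 1 then h z else 0)"

lemma disk_fun_disk_of:
  assumes "continuous_on (cball 0 1) h" "h holomorphic_on ball 0 1" "z \<in> cball 0 1"
  shows "disk_fun (disk_of h) z = h z"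
proof -
  have "continuous_on (cball 0 1) (\<lambda>z. if z \<in> cball 0 1 then h z else 0)"
    by (rule continuous_on_eq[OF assms(1)]) auto
  moreover have "(\<lambda>z. if z \<in> cball 0 1 then h z else 0) holomorphic_on ball 0 1"
    by (rule holomorphic_transform[OF assms(2)]) auto
  ultimately show ?thesis
    unfolding disk_of_def using assms(3)
    by (subst Abs_disk_algebra_inverse) (auto simp: analytic_on_open)
qed

lemma disk_fun_disk_of_entire:
  assumes "h holomorphic_on UNIV" "z \<in> cball 0 1"
  shows "disk_fun (disk_of h) z = h z"
  using assms by (meson disk_fun_disk_of holomorphic_on_imp_continuous_on holomorphic_on_subset subset_UNIV)

lemma holomorphic_on_disk_fun: "disk_fun f holomorphic_on ball 0 1"
  using disk_fun[of f] by (simp add: analytic_imp_holomorphic)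

lemma disk_fun_arith:
  "disk_fun 0 z = 0" "disk_fun (f + g) z = disk_fun f z + disk_fun g z"
  "disk_fun (f - g) z = disk_fun f z - disk_fun g z" "disk_fun (- f) z = - disk_fun f z"
  "disk_fun (f * g) z = disk_fun f z * disk_fun g z"
  by (transfer; simp)+

lemma disk_fun_1: "z \<in> cball 0 1 \<Longrightarrow> disk_fun 1 z = 1"
  by transfer simp

lemma cmod_disk_fun_diff_le: "z \<in> cball 0 1 \<Longrightarrow> cmod (disk_fun f z - disk_fun g z) \<le> dist f g"
  using norm_disk_fun_le[of z "f - g"] by (simp add: disk_fun_arith dist_norm)

section \<open>The maximum principle and boundary values\<close>

text \<open>The maximum modulus principle. It allows identities in the algebra to be checked at
  unimodular points only.\<close>

lemma norm_leI_circle: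
  assumes "\<And>z. cmod z = 1 \<Longrightarrow> cmod (disk_fun f z) \<le> B"
  shows "norm f \<le> B"
proof (rule norm_disk_algebra_leI)
  fix z :: complex assume z: "z \<in> cball 0 1"
  show "cmod (disk_fun f z) \<le> B"
  proof (rule maximum_modulus_frontier[of "disk_fun f" "cball 0 1"])
    show "disk_fun f holomorphic_on interior (cball 0 1)"
      using holomorphic_on_disk_fun[of f] by simp
    show "continuous_on (closure (cball 0 1)) (disk_fun f)"
      using continuous_on_disk_fun[of f] by simp
  qed (use z assms in auto)
qed

lemma eq_on_circleI:
  assumes "\<And>z. cmod z = 1 \<Longrightarrow> disk_fun f z = disk_fun g z"
  shows "f = g"
  using norm_leI_circle[of "f - g" 0] assms by (simp add: disk_fun_arith)

lemma norm_attained_on_circle: "\<exists>q. cmod q = 1 \<and> cmod (disk_fun f q) = norm f"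
proof -
  have "continuous_on (sphere 0 1) (\<lambda>z. cmod (disk_fun f z))"
    by (intro continuous_on_norm continuous_on_subset[OF continuous_on_disk_fun]) auto
  then obtain q where q: "cmod q = 1"
    "\<And>z. cmod z = 1 \<Longrightarrow> cmod (disk_fun f z) \<le> cmod (disk_fun f q)"
    using continuous_attains_sup[of "sphere (0::complex) 1" "\<lambda>z. cmod (disk_fun f z)"] by auto
  with norm_leI_circle[of f "cmod (disk_fun f q)"] norm_disk_fun_le[of q f] show ?thesis
    by (intro exI[of _ q]) auto
qed

text \<open>The reciprocal lies in the algebra too, so the maximum principle bounds |f| by 1 from
  above and from below. Constant modulus on the open disk forces constancy.\<close>

lemma unimodular_nonvanishing_const:
  assumes one: "\<And>z. cmod z = 1 \<Longrightarrow> cmod (disk_fun f z) = 1"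
    and nz: "\<And>z. z \<in> cball 0 1 \<Longrightarrow> disk_fun f z \<noteq> 0"
  shows "\<exists>a. cmod a = 1 \<and> (\<forall>z\<in>cball 0 1. disk_fun f z = a)"
proof -
  define g where "g = disk_of (\<lambda>z. inverse (disk_fun f z))"
  have g: "disk_fun g z = inverse (disk_fun f z)" if "z \<in> cball 0 1" for z
    unfolding g_def
    by (rule disk_fun_disk_of)
      (use nz that in \<open>auto intro!: continuous_on_inverse continuous_on_disk_fun
        holomorphic_on_inverse holomorphic_on_disk_fun\<close>)
  have "norm g \<le> 1" "norm f \<le> 1"
    by (rule norm_leI_circle; use g one in \<open>auto simp: norm_inverse\<close>)+
  then have mod1: "cmod (disk_fun f z) = 1" if "z \<in> cball 0 1" for z
    using norm_disk_fun_le[OF that, of f] norm_disk_fun_le[OF that, of g] g[OF that] nz[OF that]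
    by (auto simp: norm_inverse inverse_le_1_iff dest: order_trans)
  have "disk_fun f constant_on ball 0 1"
    by (rule maximum_modulus_principle[OF holomorphic_on_disk_fun, of "ball 0 1" 0])
      (auto simp: mod1)
  then have "disk_fun f constant_on closure (ball 0 1)"
    by (rule constant_on_closureI) (simp add: continuous_on_disk_fun)
  then show ?thesis
    using mod1[of 0] by (fastforce simp: constant_on_def)
qed

section \<open>Boundary point functionals from peak functions\<close>

lemma cnj_mult_self: "cmod b = 1 \<Longrightarrow> cnj b * b = 1"
  by (metis complex_norm_square mult.commute of_real_1 power_one)

lemma cnj_mult_cancel:
  assumes "cmod b = 1"
  shows "cnj b * (b * y) = y" "b * (cnj b * y) = y"
  using cnj_mult_self[OF assms] by (metis mult.assoc mult.commute mult_1)+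

text \<open>As n grows, |n/2 - w| = n/2 - Re w + O(1/n), since the imaginary part enters only
  quadratically.\<close>

lemma cmod_half_diff_eventually:
  assumes "0 < \<epsilon>"
  shows "\<forall>\<^sub>F n in sequentially. cmod (of_nat n / 2 - w) \<le> real n / 2 - Re w + \<epsilon>"
proof -
  have "\<forall>\<^sub>F n in sequentially. real n \<ge> (Im w)\<^sup>2 / \<epsilon> + 2 * Re w"
    by real_asymp
  then show ?thesis
  proof eventually_elim
    case (elim n)
    then have *: "(Im w)\<^sup>2 \<le> \<epsilon> * (real n - 2 * Re w)"
      using assms by (simp add: field_simps)
    have "real n - 2 * Re w \<ge> 0"
      using elim assms by (smt (verit) divide_nonneg_pos zero_le_power2)
    show ?case
    proof (rule power2_le_imp_le)
      have "(cmod (of_nat n / 2 - w))\<^sup>2 = (real n / 2 - Re w)\<^sup>2 + (Im w)\<^sup>2"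
        by (simp add: cmod_power2)
      also have "\<dots> \<le> (real n / 2 - Re w + \<epsilon>)\<^sup>2"
        using * assms by (auto simp: power2_eq_square algebra_simps intro: add_increasing)
      finally show "(cmod (of_nat n / 2 - w))\<^sup>2 \<le> (real n / 2 - Re w + \<epsilon>)\<^sup>2" .
    qed (use \<open>real n - 2 * Re w \<ge> 0\<close> assms in simp)
  qed
qed

definition peak :: "complex \<Rightarrow> complex \<Rightarrow> nat \<Rightarrow> disk_algebra"
  where "peak w p n = disk_of (\<lambda>z. of_nat n * w * (1 + cnj p * z) / 2)"

lemma disk_fun_peak: "z \<in> cball 0 1 \<Longrightarrow> disk_fun (peak w p n) z = of_nat n * w * (1 + cnj p * z) / 2"
  unfolding peak_def by (rule disk_fun_disk_of_entire) (auto intro!: holomorphic_intros)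

lemma norm_peak:
  assumes "cmod w = 1" "cmod p = 1"
  shows "norm (peak w p n) = real n"
proof (rule antisym)
  have "cnj p * p = 1"
    by (rule cnj_mult_self[OF assms(2)])
  then show "real n \<le> norm (peak w p n)"
    using norm_disk_fun_le[of p "peak w p n"] assms by (simp add: disk_fun_peak norm_mult)
  show "norm (peak w p n) \<le> real n"
  proof (rule norm_disk_algebra_leI)
    fix z :: complex assume z: "z \<in> cball 0 1"
    have "cmod (1 + cnj p * z) \<le> 1 + cmod (cnj p * z)"
      by (metis norm_one norm_triangle_ineq)
    also have "\<dots> \<le> 2" using z assms by (simp add: norm_mult)
    finally show "cmod (disk_fun (peak w p n) z) \<le> real n"
      using z assms mult_left_mono[of "cmod (1 + cnj p * z)" 2 "real n"]
      by (simp add: disk_fun_peak norm_mult norm_divide)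
  qed
qed

text \<open>Near \<open>p\<close>, continuity replaces f by f(p) and
  \<open>cmod_half_diff_eventually\<close> applies. Away from \<open>p\<close>, the peak function
  stays below a fixed fraction of n, and this linear gap outweighs \<open>norm f\<close>.\<close>

lemma norm_peak_diff_eventually:
  assumes w: "cmod w = 1" and p: "cmod p = 1" and e: "0 < \<epsilon>"
  shows "\<forall>\<^sub>F n in sequentially. norm (peak w p n - f) \<le> real n - Re (cnj w * disk_fun f p) + \<epsilon>"
proof -
  have pp: "cnj p * p = 1" and ww: "cnj w * w = 1"
    by (simp_all add: cnj_mult_self p w)
  define g where "g z = cnj w * disk_fun f z" for z
  have pc: "p \<in> cball 0 1" using p by simp
  obtain d where d: "d > 0" and
    gd: "\<And>z. z \<in> cball 0 1 \<Longrightarrow> dist z p < d \<Longrightarrow> cmod (disk_fun f z - disk_fun f p) < \<epsilon> / 2"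
    using continuous_on_disk_fun[of f, unfolded continuous_on_iff, rule_format, OF pc, of "\<epsilon> / 2"] e
    by (auto simp: dist_norm)
  \<comment> \<open>By the parallelogram law, n s / 2 bounds the peak function at distance at least
    \<open>d\<close> from \<open>p\<close>. For d > 2 the value \<open>s\<close> is negative, but
    then no such point lies in the disk.\<close>
  define s where "s = sqrt (4 - d\<^sup>2)"
  have s2: "s < 2"
    using d real_sqrt_less_mono[of "4 - d\<^sup>2" 4] by (simp add: s_def)
  have "\<forall>\<^sub>F n in sequentially. real n * s / 2 + norm f \<le> real n - Re (g p) + \<epsilon>"
  proof -
    have "\<forall>\<^sub>F n in sequentially. real n \<ge> (norm f + Re (g p)) / (1 - s / 2)"
      by real_asymp
    then show ?thesis
    proof eventually_elim
      case (elim n)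
      then have "norm f + Re (g p) \<le> real n * (1 - s / 2)"
        using s2 by (simp add: pos_divide_le_eq)
      then show ?case using e by (simp add: algebra_simps)
    qed
  qed
  moreover have "\<forall>\<^sub>F n in sequentially. cmod (of_nat n / 2 - g p) \<le> real n / 2 - Re (g p) + \<epsilon> / 2"
    by (rule cmod_half_diff_eventually) (use e in simp)
  ultimately show ?thesis
  proof eventually_elim
    case (elim n)
    show ?case
    proof (rule norm_disk_algebra_leI)
      fix z :: complex assume z: "z \<in> cball 0 1"
      define v where "v = cnj p * z"
      have v1: "cmod v \<le> 1" using z p by (simp add: v_def norm_mult)
      have "w * g z = disk_fun f z"
        using ww by (metis g_def mult.assoc mult.commute mult_1)
      then have "disk_fun (peak w p n - f) z = w * (of_nat n * (1 + v) / 2 - g z)"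
        using z by (simp add: disk_fun_arith disk_fun_peak v_def right_diff_distrib)
      then have eq: "cmod (disk_fun (peak w p n - f) z) = cmod (of_nat n * (1 + v) / 2 - g z)"
        using w by (simp add: norm_mult)
      show "cmod (disk_fun (peak w p n - f) z) \<le> real n - Re (cnj w * disk_fun f p) + \<epsilon>"
      proof (cases "dist z p < d")
        case True
        \<comment> \<open>The varying half of the peak function costs at most n/2; the constant half
          n/2 is where Re (g p) is gained.\<close>
        have "of_nat n * (1 + v) / 2 - g z = of_nat n * v / 2 + (of_nat n / 2 - g p) + (g p - g z)"
          by (simp add: algebra_simps add_divide_distrib)
        also have "cmod \<dots> \<le> cmod (of_nat n * v / 2) + cmod (of_nat n / 2 - g p) + cmod (g p - g z)"
          by (meson norm_triangle_ineq norm_triangle_mono order_refl)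
        also have "cmod (of_nat n * v / 2) \<le> real n / 2"
          using v1 by (simp add: norm_mult norm_divide mult_left_le)
        also have "g p - g z = cnj w * (disk_fun f p - disk_fun f z)"
          by (simp add: g_def algebra_simps)
        also have "cmod \<dots> \<le> \<epsilon> / 2"
          using gd[OF z True] w by (simp add: norm_mult norm_minus_commute)
        finally show ?thesis
          using elim(2) unfolding eq by (simp add: g_def)
      next
        case False
        have "(cmod (1 + v))\<^sup>2 + (cmod (1 - v))\<^sup>2 = 2 + 2 * (cmod v)\<^sup>2"
          unfolding cmod_power2 by (simp add: power2_eq_square algebra_simps)
        moreover have "1 - v = cnj p * (p - z)"
          using pp by (simp add: v_def algebra_simps)
        then have "cmod (1 - v) \<ge> d"
          using False p by (simp add: norm_mult dist_norm norm_minus_commute)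
        then have "(cmod (1 - v))\<^sup>2 \<ge> d\<^sup>2"
          using d by (intro power_mono) auto
        moreover have "(cmod v)\<^sup>2 \<le> 1"
          using v1 by (simp add: power_le_one)
        ultimately have "(cmod (1 + v))\<^sup>2 \<le> 4 - d\<^sup>2"
          by linarith
        then have "cmod (1 + v) \<le> s"
          unfolding s_def by (rule real_le_rsqrt)
        then have "cmod (of_nat n * (1 + v) / 2) \<le> real n * s / 2"
          by (simp add: norm_mult norm_divide mult_left_mono)
        moreover have "cmod (g z) \<le> norm f"
          using norm_disk_fun_le[OF z, of f] w by (simp add: g_def norm_mult)
        ultimately show ?thesis
          using elim(1) norm_triangle_ineq4[of "of_nat n * (1 + v) / 2" "g z"]
          unfolding eq by (simp add: g_def)
      qed
    qed
  qed
qed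

text \<open>The image of the n-th peak function attains its norm n at a boundary point
  \<open>q n\<close> with phase \<open>b n\<close>. Comparison with T f at that point gives the
  inequality up to an error. The pairs (b n, q n) do not depend on f, so one limit point serves all
  f.\<close>

lemma isometry_peak_functional:
  assumes iso: "\<And>f g. dist (T f) (T g) = dist f g" and T0: "T 0 = (0 :: disk_algebra)"
    and w: "cmod w = 1" and p: "cmod p = 1"
  shows "\<exists>b q. cmod b = 1 \<and> cmod q = 1 \<and>
    (\<forall>f. Re (cnj w * disk_fun f p) \<le> Re (cnj b * disk_fun (T f) q))"
proof -
  have nT: "norm (T f) = norm f" for f
    using iso[of f 0] T0 by simp
  have "\<exists>b q. cmod b = 1 \<and> cmod q = 1 \<and> disk_fun (T (peak w p n)) q = of_nat n * b" for n
  proof (cases "n = 0")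
    case True
    \<comment> \<open>For n = 0 there is no phase to read off; the image is 0 and any unimodular
      numbers do.\<close>
    have "T (peak w p n) = 0"
      using nT[of "peak w p n"] norm_peak[OF w p, of n] True by simp
    then show ?thesis using True
      by (intro exI[of _ 1]) (simp add: disk_fun_arith)
  next
    case False
    obtain q where "cmod q = 1" "cmod (disk_fun (T (peak w p n)) q) = n"
      using norm_attained_on_circle[of "T (peak w p n)"] nT norm_peak[OF w p] by auto
    then show ?thesis using False
      by (intro exI[of _ "disk_fun (T (peak w p n)) q / of_nat n"] exI[of _ q]) (auto simp: norm_divide)
  qed
  then obtain b q where b: "\<And>n. cmod (b n) = 1" and q: "\<And>n. cmod (q n) = 1"
    and bq: "\<And>n. disk_fun (T (peak w p n)) (q n) = of_nat n * b n"
    by metis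
  have "seq_compact (sphere (0::complex) 1 \<times> sphere (0::complex) 1)"
    by (simp add: compact_imp_seq_compact compact_Times)
  moreover have "\<forall>n. (b n, q n) \<in> sphere 0 1 \<times> sphere 0 1"
    using b q by simp
  ultimately obtain l r where l: "l \<in> sphere (0::complex) 1 \<times> sphere (0::complex) 1" and
    r: "strict_mono (r :: nat \<Rightarrow> nat)" and lim: "((\<lambda>n. (b n, q n)) \<circ> r) \<longlonglongrightarrow> l"
    by (rule seq_compactE)
  define b' q' where "b' = fst l" and "q' = snd l"
  have b': "cmod b' = 1" and q': "cmod q' = 1"
    using l by (auto simp: b'_def q'_def mem_Times_iff)
  have limb: "(\<lambda>n. b (r n)) \<longlonglongrightarrow> b'" and limq: "(\<lambda>n. q (r n)) \<longlonglongrightarrow> q'"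
    using tendsto_fst[OF lim] tendsto_snd[OF lim] by (simp_all add: b'_def q'_def o_def)
  have "Re (cnj w * disk_fun f p) \<le> Re (cnj b' * disk_fun (T f) q')" for f
  proof (rule field_le_epsilon)
    fix \<epsilon> :: real assume e: "0 < \<epsilon>"
    have ev: "\<forall>\<^sub>F n in sequentially.
      Re (cnj w * disk_fun f p) - \<epsilon> \<le> Re (cnj (b (r n)) * disk_fun (T f) (q (r n)))"
      using eventually_subseq[OF r norm_peak_diff_eventually[OF w p e, of f]]
    proof eventually_elim
      case (elim n)
      define m where "m = r n"
      have bb: "cnj (b m) * b m = 1"
        by (rule cnj_mult_self[OF b])
      have "real m - Re (cnj (b m) * disk_fun (T f) (q m))
        = Re (cnj (b m) * (of_nat m * b m - disk_fun (T f) (q m)))"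
        using bb by (simp add: right_diff_distrib mult.left_commute del: complex_cnj_cnj times_complex.sel)
      also have "\<dots> \<le> cmod (of_nat m * b m - disk_fun (T f) (q m))"
        using complex_Re_le_cmod b by (metis complex_mod_cnj mult_1 norm_mult)
      also have "\<dots> \<le> dist (T (peak w p m)) (T f)"
        using cmod_disk_fun_diff_le[of "q m"] q bq[of m] by (metis dist_0_norm mem_cball order_refl)
      also have "\<dots> \<le> real m - Re (cnj w * disk_fun f p) + \<epsilon>"
        using elim unfolding iso by (simp add: dist_norm m_def)
      finally show ?case by (simp add: m_def)
    qed
    have "continuous_on (cball 0 1) (disk_fun (T f))"
      by (rule continuous_on_disk_fun)
    then have "(\<lambda>n. disk_fun (T f) (q (r n))) \<longlonglongrightarrow> disk_fun (T f) q'"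
      by (rule continuous_on_tendsto_compose[OF _ limq]) (use q q' in auto)
    then have "(\<lambda>n. Re (cnj (b (r n)) * disk_fun (T f) (q (r n))))
      \<longlonglongrightarrow> Re (cnj b' * disk_fun (T f) q')"
      by (intro tendsto_intros limb)
    from tendsto_lowerbound[OF this ev]
    show "Re (cnj w * disk_fun f p) \<le> Re (cnj b' * disk_fun (T f) q') + \<epsilon>" by simp
  qed
  with b' q' show ?thesis by blast
qed

definition const_fun :: "complex \<Rightarrow> disk_algebra"
  where "const_fun c = disk_of (\<lambda>_. c)"

lemma disk_fun_const: "z \<in> cball 0 1 \<Longrightarrow> disk_fun (const_fun c) z = c"
  unfolding const_fun_def by (rule disk_fun_disk_of_entire) auto

lemma const_fun_0: "const_fun 0 = 0"
  by (rule disk_algebra_eqI) (simp add: disk_fun_const disk_fun_arith)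

lemma eq_1_if_Re_ge_1:
  assumes "cmod x \<le> 1" "1 \<le> Re x"
  shows "x = 1"
proof -
  have "(Re x)\<^sup>2 + (Im x)\<^sup>2 \<le> 1"
    using assms(1) cmod_power2[of x] power_le_one[of "cmod x" 2] by simp
  moreover have "(Re x)\<^sup>2 \<ge> 1"
    using assms(2) one_le_power by blast
  ultimately have "(Im x)\<^sup>2 = 0"
    using zero_le_power2[of "Im x"] by linarith
  moreover have "Re x = 1"
    using assms complex_Re_le_cmod[of x] by linarith
  ultimately show ?thesis
    by (simp add: complex_eq_iff)
qed

section \<open>The form of surjective isometries\<close>

lemma IsoD:
  assumes "L \<in> Iso"
  shows "dist (L f) (L g) = dist f g" "surj L" "inj L"
proof -
  show d: "dist (L f) (L g) = dist f g" for f g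
    using assms by (simp add: Iso_def)
  show "surj L" using assms by (simp add: Iso_def)
  show "inj L" by (rule injI) (metis d dist_eq_0_iff)
qed

lemma inv_in_Iso:
  assumes "L \<in> Iso"
  shows "inv L \<in> Iso"
proof -
  have "dist (inv L f) (inv L g) = dist f g" for f g
    using IsoD(1)[OF assms, of "inv L f" "inv L g"] surj_f_inv_f[OF IsoD(2)[OF assms]] by simp
  then show ?thesis
    using inj_imp_surj_inv[OF IsoD(3)[OF assms]] by (simp add: Iso_def)
qed

text \<open>Equality comes from applying the inequality to \<open>L\<close> and then to its inverse: evaluated at a peak
  function, the composite inequality forces the final point to be \<open>p\<close> again.\<close>

lemma Iso_functional:
  assumes L: "L \<in> Iso" "L 0 = (0::disk_algebra)" and w: "cmod w = 1" and p: "cmod p = 1"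
  shows "\<exists>b q. cmod b = 1 \<and> cmod q = 1 \<and>
    (\<forall>f. Re (cnj w * disk_fun f p) = Re (cnj b * disk_fun (L f) q))"
proof -
  note LD = IsoD[OF L(1)]
  have K: "inv L \<in> Iso" "inv L 0 = 0"
    using inv_in_Iso[OF L(1)] L(2) inv_f_f[OF LD(3), of 0] by simp_all
  obtain b q where b: "cmod b = 1" and q: "cmod q = 1"
    and 1: "\<And>f. Re (cnj w * disk_fun f p) \<le> Re (cnj b * disk_fun (L f) q)"
    using isometry_peak_functional[of L w p] LD(1) L(2) w p by metis
  obtain w' p' where w': "cmod w' = 1" and p': "cmod p' = 1"
    and 2: "\<And>f. Re (cnj b * disk_fun f q) \<le> Re (cnj w' * disk_fun (inv L f) p')"
    using isometry_peak_functional[of "inv L" b q] IsoD(1)[OF K(1)] K(2) b q by metis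
  have 3: "Re (cnj b * disk_fun (L f) q) \<le> Re (cnj w' * disk_fun f p')" for f
    using 2[of "L f"] inv_f_f[OF LD(3)] by simp
  define x where "x = cnj w' * w"
  define v where "v = cnj p * p'"
  have xv: "cmod x = 1" "cmod (x * v) = 1"
    using w w' p p' by (simp_all add: x_def v_def norm_mult)
  \<comment> \<open>The function \<open>peak w p 2\<close> is w (1 + cnj p z), so the inequality
    becomes 2 \<le> Re x + Re (x v) with two unimodular terms, both of which must be 1.\<close>
  have "Re (cnj w * disk_fun (peak w p 2) p) \<le> Re (cnj w' * disk_fun (peak w p 2) p')"
    using 1 3 order_trans by blast
  also have "disk_fun (peak w p 2) p' = w * (1 + v)"
    using p' by (simp add: disk_fun_peak v_def)
  also have "cnj w' * \<dots> = x + x * v"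
    by (simp add: x_def algebra_simps)
  also have "disk_fun (peak w p 2) p = w * 2"
    using p cnj_mult_self[OF p] by (simp add: disk_fun_peak)
  also have "cnj w * \<dots> = 2"
    using cnj_mult_self[OF w] by (simp add: mult.assoc[symmetric])
  finally have "2 \<le> Re x + Re (x * v)"
    by simp
  then have "1 \<le> Re x" "1 \<le> Re (x * v)"
    using xv complex_Re_le_cmod[of x] complex_Re_le_cmod[of "x * v"] by linarith+
  then have "x = 1" "x * v = 1"
    using xv eq_1_if_Re_ge_1 by simp_all
  then have "cnj w' * w = 1" "cnj p * p' = 1"
    by (simp_all add: x_def v_def)
  then have "w' = w" "p' = p"
    using cnj_mult_self[OF w'] cnj_mult_self[OF p] by (metis mult_cancel_left mult_zero_left zero_neq_one)+
  then show ?thesis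
    using b q 1 3 by (metis order_antisym)
qed

text \<open>For \<open>w = 1\<close> and \<open>w = \<i>\<close>, \<open>Iso_functional\<close>
  reads the real and the imaginary part of f(p) off boundary values of L f. Taken at one point, with
  phases differing by the factor i or -i, they combine to f(p) or its conjugate.\<close>

lemma Iso_point_evaluation:
  assumes L: "L \<in> Iso" "L 0 = (0::disk_algebra)" and p: "cmod p = 1"
  shows "\<exists>q b. cmod q = 1 \<and> cmod b = 1 \<and>
    ((\<forall>f. disk_fun (L f) q = b * disk_fun f p) \<or> (\<forall>f. disk_fun (L f) q = b * cnj (disk_fun f p)))"
proof -
  obtain b1 q1 where b1: "cmod b1 = 1" and q1: "cmod q1 = 1"
    and f1: "\<And>f. Re (disk_fun f p) = Re (cnj b1 * disk_fun (L f) q1)"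
    using Iso_functional[OF L, of 1 p] p by auto
  obtain b2 q2 where b2: "cmod b2 = 1" and q2: "cmod q2 = 1"
    and f2: "\<And>f. Im (disk_fun f p) = Re (cnj b2 * disk_fun (L f) q2)"
    using Iso_functional[OF L, of \<i> p] p by auto
  \<comment> \<open>A third unimodular functional at \<open>p\<close>, a combination of the first two: as it too comes from a
    single point \<open>q\<close>, the points \<open>q1\<close> and \<open>q2\<close> must agree, and \<open>b1\<close>, \<open>b2\<close> must be orthogonal.\<close>
  have "cmod (Complex (3/5) (4/5)) = 1"
    by (simp add: cmod_def power2_eq_square)
  then obtain b q where b: "cmod b = 1" and q: "cmod q = 1"
    and f3: "\<And>f. Re (cnj (Complex (3/5) (4/5)) * disk_fun f p) = Re (cnj b * disk_fun (L f) q)"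
    using Iso_functional[OF L _ p] by metis
  \<comment> \<open>Surjectivity of \<open>L\<close> gives the relation for arbitrary
    \<open>g\<close>, so that polynomials may be inserted.\<close>
  have *: "3/5 * Re (cnj b1 * disk_fun g q1) + 4/5 * Re (cnj b2 * disk_fun g q2)
    = Re (cnj b * disk_fun g q)" for g
  proof -
    obtain f where "g = L f"
      using IsoD(2)[OF L(1)] by (metis surjD)
    then show ?thesis
      using f1[of f] f2[of f] f3[of f] by (simp del: times_complex.sel(2))
  qed
  note sel = times_complex.sel
  have quad: "disk_fun (disk_of (\<lambda>z. c * (z - s) * (z - t))) z = c * (z - s) * (z - t)"
    if "cmod z = 1" for c s t z
    using that by (intro disk_fun_disk_of_entire) (auto intro!: holomorphic_intros)
  have lin: "disk_fun (disk_of (\<lambda>z. c * (z - s))) z = c * (z - s)"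
    if "cmod z = 1" for c s z
    using that by (intro disk_fun_disk_of_entire) (auto intro!: holomorphic_intros)
  note bb = cnj_mult_self[OF b] cnj_mult_self[OF b1] cnj_mult_self[OF b2]
  have "q1 = q2"
  proof (rule ccontr)
    assume ne: "q1 \<noteq> q2"
    \<comment> \<open>Each test polynomial vanishes at all but one of the distinct points and equals
      the matching phase at the remaining one. The relation then reads 0 = 1, 4/5 = 0 or 3/5 =
      0.\<close>
    consider "q \<noteq> q1" "q \<noteq> q2" | "q = q1" | "q = q2" by blast
    then show False
    proof cases
      case 1
      then have "b / ((q - q1) * (q - q2)) * (q - q1) * (q - q2) = b"
        by simp
      then show False
        using *[of "disk_of (\<lambda>z. b / ((q - q1) * (q - q2)) * (z - q1) * (z - q2))"] bb
        by (simp add: quad[OF q] quad[OF q1] quad[OF q2] del: sel times_divide_eq_left)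
    next
      case 2
      have "b2 / (q2 - q1) * (q2 - q1) = b2"
        using ne by simp
      with 2 show False
        using *[of "disk_of (\<lambda>z. b2 / (q2 - q1) * (z - q1))"] bb ne
        by (simp add: lin[OF q] lin[OF q1] lin[OF q2] del: sel times_divide_eq_left)
    next
      case 3
      have "b1 / (q1 - q2) * (q1 - q2) = b1"
        using ne by simp
      with 3 show False
        using *[of "disk_of (\<lambda>z. b1 / (q1 - q2) * (z - q2))"] bb ne
        by (simp add: lin[OF q] lin[OF q1] lin[OF q2] del: sel times_divide_eq_left)
    qed
  qed
  moreover have "q1 = q"
  proof (rule ccontr)
    assume ne: "q1 \<noteq> q"
    then have "b / (q - q1) * (q - q1) = b"
      by simp
    then show False
      using *[of "disk_of (\<lambda>z. b / (q - q1) * (z - q1))"] bb \<open>q1 = q2\<close>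
      by (simp add: lin[OF q] lin[OF q1] lin[OF q2] del: sel times_divide_eq_left)
  qed
  ultimately have qs: "q1 = q" "q2 = q" by auto
  have "Re b = 3/5 * Re b1 + 4/5 * Re b2" "Im b = 3/5 * Im b1 + 4/5 * Im b2"
    using *[of "const_fun 1"] *[of "const_fun \<i>"] q by (simp_all add: qs disk_fun_const)
  then have bsq: "(3/5 * Re b1 + 4/5 * Re b2)\<^sup>2 + (3/5 * Im b1 + 4/5 * Im b2)\<^sup>2 = 1"
    using b cmod_power2[of b] by simp
  have b1sq: "(Re b1)\<^sup>2 + (Im b1)\<^sup>2 = 1" and b2sq: "(Re b2)\<^sup>2 + (Im b2)\<^sup>2 = 1"
    using b1 b2 cmod_power2[of b1] cmod_power2[of b2] by simp_all
  \<comment> \<open>As 9/25 + 16/25 = 1, expanding |b|^2 = 1 leaves only the cross term 24/25 Re x,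
    which therefore vanishes.\<close>
  define x where "x = cnj b1 * b2"
  have "Re x = Re b1 * Re b2 + Im b1 * Im b2"
    by (simp add: x_def)
  also have "\<dots> = 0"
    using bsq b1sq b2sq unfolding power2_eq_square by (simp add: algebra_simps)
  finally have Rx: "Re x = 0" .
  moreover have "cmod x = 1"
    using b1 b2 by (simp add: x_def norm_mult)
  ultimately have "(Im x)\<^sup>2 = 1"
    using cmod_power2[of x] by simp
  then have "x = \<i> \<or> x = - \<i>"
    using Rx by (auto simp: power2_eq_1_iff complex_eq_iff)
  moreover have b2x: "b2 = b1 * x"
    using b1 by (simp add: x_def cnj_mult_cancel)
  ultimately consider "b2 = b1 * \<i>" | "b2 = - b1 * \<i>" by fastforce
  then show ?thesis
  proof cases
    case 1
    have "disk_fun f p = cnj b1 * disk_fun (L f) q" for f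
      using f1[of f] f2[of f] by (simp add: complex_eq_iff 1 qs algebra_simps)
    then have "disk_fun (L f) q = b1 * disk_fun f p" for f
      using b1 by (metis cnj_mult_cancel(2))
    then show ?thesis using q b1 by blast
  next
    case 2
    have "cnj (disk_fun f p) = cnj b1 * disk_fun (L f) q" for f
      using f1[of f] f2[of f] by (simp add: complex_eq_iff 2 qs algebra_simps)
    then have "disk_fun (L f) q = b1 * cnj (disk_fun f p)" for f
      using b1 by (metis cnj_mult_cancel(2))
    then show ?thesis using q b1 by blast
  qed
qed

text \<open>\<open>Iso_point_evaluation\<close> finds q from p; applied to \<open>inv L\<close> it
  finds p from a prescribed q.\<close>

lemma Iso_value_at:
  assumes L: "L \<in> Iso" "L 0 = (0::disk_algebra)" and q: "cmod q = 1"
  shows "\<exists>p b. cmod p = 1 \<and> cmod b = 1 \<and>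
    ((\<forall>f. disk_fun (L f) q = b * disk_fun f p) \<or> (\<forall>f. disk_fun (L f) q = b * cnj (disk_fun f p)))"
proof -
  have inj: "inj L" by (rule IsoD[OF L(1)])
  have "inv L \<in> Iso" "inv L 0 = 0"
    using inv_in_Iso[OF L(1)] L(2) inv_f_f[OF inj, of 0] by simp_all
  from Iso_point_evaluation[OF this q] obtain p b where p: "cmod p = 1" and b: "cmod b = 1" and
    *: "(\<forall>f. disk_fun (inv L f) p = b * disk_fun f q) \<or> (\<forall>f. disk_fun (inv L f) p = b * cnj (disk_fun f q))"
    by blast
  from * show ?thesis
  proof
    assume "\<forall>f. disk_fun (inv L f) p = b * disk_fun f q"
    then have "disk_fun f p = b * disk_fun (L f) q" for f
      using inv_f_f[OF inj] by metis
    then have "disk_fun (L f) q = cnj b * disk_fun f p" for f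
      using b by (simp add: cnj_mult_cancel)
    then show ?thesis using p b by (metis complex_mod_cnj)
  next
    assume "\<forall>f. disk_fun (inv L f) p = b * cnj (disk_fun f q)"
    then have "disk_fun f p = b * cnj (disk_fun (L f) q)" for f
      using inv_f_f[OF inj] by metis
    then have "disk_fun (L f) q = b * cnj (disk_fun f p)" for f
      using b by (simp add: cnj_mult_cancel)
    then show ?thesis using p b by blast
  qed
qed

lemma finite_range_constant:
  assumes "connected S" "continuous_on S h" "finite F" "\<And>x. x \<in> S \<Longrightarrow> h x \<in> F"
  shows "\<exists>c. \<forall>x\<in>S. h x = (c :: complex)"
  using continuous_finite_range_constant[OF assms(1,2)] finite_subset[of "h ` S" F] assms(3,4)
  by (auto simp: constant_on_def)

lemma connected_unit_circle: "connected (sphere (0::complex) 1)"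
  by (rule connected_sphere) simp

lemma continuous_on_circle: "continuous_on (sphere 0 1) (disk_fun f)"
  by (rule continuous_on_subset[OF continuous_on_disk_fun]) auto

text \<open>\<open>Iso_value_at\<close> gives this form pointwise; the factor and the choice between
  value and conjugate must be made independent of q. The factor is the boundary value of
  \<open>L 1\<close>, which is zero-free and hence constant.\<close>

lemma Iso_form:
  assumes L: "L \<in> Iso" "L 0 = (0::disk_algebra)"
  obtains a \<tau> where "cmod a = 1" "\<And>q. cmod q = 1 \<Longrightarrow> cmod (\<tau> q) = 1" "inj_on \<tau> (sphere 0 1)"
    "(\<forall>f q. cmod q = 1 \<longrightarrow> disk_fun (L f) q = a * disk_fun f (\<tau> q)) \<or>
     (\<forall>f q. cmod q = 1 \<longrightarrow> disk_fun (L f) q = a * cnj (disk_fun f (\<tau> q)))"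
proof -
  obtain \<tau> b where \<tau>: "\<And>q. cmod q = 1 \<Longrightarrow> cmod (\<tau> q) = 1" and b: "\<And>q. cmod q = 1 \<Longrightarrow> cmod (b q) = 1"
    and Lb: "\<And>q. cmod q = 1 \<Longrightarrow> (\<forall>f. disk_fun (L f) q = b q * disk_fun f (\<tau> q)) \<or>
      (\<forall>f. disk_fun (L f) q = b q * cnj (disk_fun f (\<tau> q)))"
    using Iso_value_at[OF L] by metis
  have L1: "disk_fun (L 1) q = b q" if "cmod q = 1" for q
    using Lb[OF that] \<tau>[OF that] by (auto simp: disk_fun_1)
  \<comment> \<open>Squaring commutes with conjugation, so the identity holds under either
    alternative. At a zero of \<open>L 1\<close> every L f would vanish, although L f = 1 for some
    f.\<close>
  have sq: "L 1 * L (f * f) = L f * L f" for f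
  proof (rule eq_on_circleI)
    fix q assume q: "cmod q = 1"
    show "disk_fun (L 1 * L (f * f)) q = disk_fun (L f * L f) q"
      using Lb[OF q] L1[OF q] by (auto simp: disk_fun_arith)
  qed
  have "disk_fun (L 1) z \<noteq> 0" if z: "z \<in> cball 0 1" for z
  proof
    assume 0: "disk_fun (L 1) z = 0"
    obtain f where "L f = 1" using IsoD(2)[OF L(1)] by (metis surjD)
    then show False
      using 0 z arg_cong[OF sq[of f], of "\<lambda>h. disk_fun h z"] by (simp add: disk_fun_arith disk_fun_1)
  qed
  moreover have "cmod (disk_fun (L 1) q) = 1" if "cmod q = 1" for q
    unfolding L1[OF that] by (rule b[OF that])
  ultimately obtain a where a: "cmod a = 1" "\<And>z. z \<in> cball 0 1 \<Longrightarrow> disk_fun (L 1) z = a"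
    using unimodular_nonvanishing_const[of "L 1"] by blast
  have ba: "b q = a" if "cmod q = 1" for q
    using that L1[OF that] a(2)[of q] by simp
  have inj: "inj_on \<tau> (sphere 0 1)"
  proof (rule inj_onI)
    fix q q' assume q: "q \<in> sphere 0 1" "q' \<in> sphere 0 1" "\<tau> q = \<tau> q'"
    \<comment> \<open>On the circle this L f vanishes only at \<open>q\<close>, while its moduli at
      \<open>q\<close> and \<open>q'\<close> agree because
      \<open>\<tau> q = \<tau> q'\<close>.\<close>
    obtain f where f: "L f = disk_of (\<lambda>z. z - q)" using IsoD(2)[OF L(1)] by (metis surjD)
    have g: "disk_fun (disk_of (\<lambda>z. z - q)) z = z - q" if "cmod z = 1" for z
      using that by (intro disk_fun_disk_of_entire) (auto intro!: holomorphic_intros)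
    have "cmod (disk_fun (L f) q) = cmod (disk_fun (L f) q')"
      using Lb[of q] Lb[of q'] b[of q] b[of q'] q by (auto simp: norm_mult)
    then show "q = q'"
      using q by (simp add: f g)
  qed
  have a0: "a \<noteq> 0" using a(1) by auto
  \<comment> \<open>The value is i in the linear alternative and -i in the conjugate one, so its
    constancy along the connected circle decides for all q at once.\<close>
  have vals: "disk_fun (L (const_fun \<i>)) q / a \<in> {\<i>, - \<i>}" if "q \<in> sphere 0 1" for q
  proof -
    have q: "cmod q = 1" using that by simp
    show ?thesis
      using Lb[OF q] \<tau>[OF q] a0 unfolding ba[OF q] by (auto simp: disk_fun_const)
  qed
  have "continuous_on (sphere 0 1) (\<lambda>q. disk_fun (L (const_fun \<i>)) q / a)"
    using a0 by (intro continuous_on_divide continuous_on_circle continuous_on_const) auto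
  from finite_range_constant[OF connected_unit_circle this _ vals]
  obtain c where c: "\<And>q. cmod q = 1 \<Longrightarrow> disk_fun (L (const_fun \<i>)) q / a = c"
    by auto
  have ci: "disk_fun (L (const_fun \<i>)) q = a * c" if "cmod q = 1" for q
    using c[OF that] a0 by (simp add: field_simps)
  show thesis
  proof (rule that[OF a(1) \<tau> inj])
    show "(\<forall>f q. cmod q = 1 \<longrightarrow> disk_fun (L f) q = a * disk_fun f (\<tau> q)) \<or>
     (\<forall>f q. cmod q = 1 \<longrightarrow> disk_fun (L f) q = a * cnj (disk_fun f (\<tau> q)))"
    proof (cases "c = \<i>")
      case True
      have "\<not> (\<forall>f. disk_fun (L f) q = b q * cnj (disk_fun f (\<tau> q)))" if q: "cmod q = 1" for q
      proof
        assume "\<forall>f. disk_fun (L f) q = b q * cnj (disk_fun f (\<tau> q))"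
        then have "disk_fun (L (const_fun \<i>)) q = a * (- \<i>)"
          using ba[OF q] \<tau>[OF q] by (simp add: disk_fun_const)
        then have "a * c = a * (- \<i>)"
          unfolding ci[OF q] .
        then have "c = - \<i>"
          using a0 by (metis mult_cancel_left)
        with True show False
          by (simp add: complex_eq_iff)
      qed
      from Lb this have "disk_fun (L f) q = a * disk_fun f (\<tau> q)" if "cmod q = 1" for f q
        unfolding ba[OF that, symmetric] using that by blast
      then show ?thesis by blast
    next
      case False
      have "\<not> (\<forall>f. disk_fun (L f) q = b q * disk_fun f (\<tau> q))" if q: "cmod q = 1" for q
      proof
        assume "\<forall>f. disk_fun (L f) q = b q * disk_fun f (\<tau> q)"
        then have "disk_fun (L (const_fun \<i>)) q = a * (\<i>)"
          using ba[OF q] \<tau>[OF q] by (simp add: disk_fun_const)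
        then have "a * c = a * (\<i>)"
          unfolding ci[OF q] .
        then have "c = \<i>"
          using a0 by (metis mult_cancel_left)
        with False show False
          by (simp add: complex_eq_iff)
      qed
      from Lb this have "disk_fun (L f) q = a * cnj (disk_fun f (\<tau> q))" if "cmod q = 1" for f q
        unfolding ba[OF that, symmetric] using that by blast
      then show ?thesis by blast
    qed
  qed
qed

section \<open>Rotations, reflection and other explicit isometries\<close>

lemma disk_fun_rotate:
  assumes a: "cmod a = 1" and z: "z \<in> cball 0 1"
  shows "disk_fun (disk_of (\<lambda>w. disk_fun h (a * w))) z = disk_fun h (a * z)"
proof (rule disk_fun_disk_of[OF _ _ z])
  show "continuous_on (cball 0 1) (\<lambda>w. disk_fun h (a * w))"
    by (rule continuous_on_compose2[OF continuous_on_disk_fun])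
      (use a in \<open>auto simp: norm_mult intro!: continuous_intros\<close>)
  have "(disk_fun h \<circ> (\<lambda>w. a * w)) holomorphic_on ball 0 1"
    by (rule holomorphic_on_compose_gen[OF _ holomorphic_on_disk_fun])
      (use a in \<open>auto simp: norm_mult intro!: holomorphic_intros\<close>)
  then show "(\<lambda>w. disk_fun h (a * w)) holomorphic_on ball 0 1"
    by (simp add: o_def)
qed

text \<open>Conjugating argument and value together preserves analyticity; this conjugate-linear
  isometry exchanges the constants i and -i.\<close>

definition cnj_reflect :: "disk_algebra \<Rightarrow> disk_algebra"
  where "cnj_reflect h = disk_of (\<lambda>z. cnj (disk_fun h (cnj z)))"

lemma disk_fun_cnj_reflect:
  assumes z: "z \<in> cball 0 1"
  shows "disk_fun (cnj_reflect h) z = cnj (disk_fun h (cnj z))"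
  unfolding cnj_reflect_def
proof (rule disk_fun_disk_of[OF _ _ z])
  show "continuous_on (cball 0 1) (\<lambda>z. cnj (disk_fun h (cnj z)))"
    by (intro continuous_on_cnj continuous_on_compose2[OF continuous_on_disk_fun[of h]])
      (auto intro!: continuous_intros)
  have "cnj ` ball 0 1 \<subseteq> ball 0 1"
    by auto
  then have "cnj \<circ> disk_fun h \<circ> cnj holomorphic_on ball 0 1"
    using holomorphic_on_subset[OF holomorphic_on_disk_fun]
    by (intro holomorphic_on_compose_cnj_cnj) auto
  then show "(\<lambda>z. cnj (disk_fun h (cnj z))) holomorphic_on ball 0 1"
    by (simp add: o_def)
qed

lemma cnj_reflect_in_Iso: "cnj_reflect \<in> Iso"
proof -
  have twice: "cnj_reflect (cnj_reflect f) = f" for f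
    by (rule disk_algebra_eqI) (simp add: disk_fun_cnj_reflect)
  have diff: "cnj_reflect f - cnj_reflect g = cnj_reflect (f - g)" for f g
    by (rule disk_algebra_eqI) (simp add: disk_fun_cnj_reflect disk_fun_arith)
  have le: "norm (cnj_reflect f) \<le> norm f" for f
    by (rule norm_disk_algebra_leI) (simp add: disk_fun_cnj_reflect norm_disk_fun_le)
  have "norm (cnj_reflect f) = norm f" for f
    using le[of f] le[of "cnj_reflect f"] by (simp add: twice)
  then have "dist (cnj_reflect f) (cnj_reflect g) = dist f g" for f g
    by (simp add: dist_norm diff)
  then show ?thesis
    unfolding Iso_def using surjI[of cnj_reflect cnj_reflect, OF twice] by simp
qed

lemma mult_const_in_Iso:
  assumes "cmod a = 1"
  shows "(\<lambda>f. const_fun a * f) \<in> Iso"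
proof -
  have inv: "const_fun b * (const_fun (cnj b) * f) = f" if "cmod b = 1" for b f
    using that by (intro disk_algebra_eqI) (simp add: disk_fun_arith disk_fun_const cnj_mult_cancel)
  have le: "norm (const_fun b * f) \<le> norm f" if "cmod b = 1" for b f
    using that
    by (intro norm_disk_algebra_leI) (simp add: disk_fun_arith disk_fun_const norm_mult norm_disk_fun_le)
  have "norm (const_fun a * f) = norm f" for f
    using le[of a f] le[of "cnj a" "const_fun a * f"] inv[of "cnj a" f] assms by simp
  then have "dist (const_fun a * f) (const_fun a * g) = dist f g" for f g
    by (simp add: dist_norm flip: right_diff_distrib)
  then show ?thesis
    unfolding Iso_def using surjI[of "\<lambda>f. const_fun a * f", OF inv[OF assms]] by simp
qed

lemma diff_const_in_Iso: "(\<lambda>x. x - c) \<in> Iso"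
  unfolding Iso_def by (auto intro: surjI[of _ "\<lambda>x. x + c"] simp: dist_norm)

lemma comp_in_Iso: "U \<in> Iso \<Longrightarrow> V \<in> Iso \<Longrightarrow> U \<circ> V \<in> Iso"
  unfolding Iso_def using comp_surj[of V U] by simp

lemma Iso_comp_cancel:
  assumes "U \<in> Iso" "U \<circ> T \<in> Iso"
  shows "T \<in> Iso"
proof -
  have "inv U \<circ> (U \<circ> T) = T"
    using IsoD(3)[OF assms(1)] by (simp add: o_assoc)
  then show ?thesis
    using comp_in_Iso[OF inv_in_Iso[OF assms(1)] assms(2)] by simp
qed

section \<open>2-local maps\<close>

lemma two_local_in_Iso_comp:
  assumes "U \<in> Iso" "two_local_in_Iso T"
  shows "two_local_in_Iso (U \<circ> T)"
  unfolding two_local_in_Iso_def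
proof (intro allI)
  fix x y
  obtain V where "V \<in> Iso" "T x = V x" "T y = V y"
    using assms(2) unfolding two_local_in_Iso_def by blast
  then show "\<exists>V\<in>Iso. (U \<circ> T) x = V x \<and> (U \<circ> T) y = V y"
    using comp_in_Iso[OF assms(1)] by (intro bexI[of _ "U \<circ> V"]) auto
qed

lemma two_local_in_Iso_dist:
  assumes "two_local_in_Iso T"
  shows "dist (T f) (T g) = dist f g"
  using assms IsoD(1) unfolding two_local_in_Iso_def by metis

text \<open>The surjective isometry agreeing with \<open>T\<close> at \<open>f\<close> and
  \<open>g\<close>, translated to fix 0, falls under \<open>Iso_form\<close>. Both \<open>a\<close>
  and \<open>\<tau>\<close> depend on the pair.\<close>

lemma two_local_diff:
  assumes "two_local_in_Iso (T :: disk_algebra \<Rightarrow> disk_algebra)"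
  obtains a \<tau> where "cmod a = 1" "\<And>q. cmod q = 1 \<Longrightarrow> cmod (\<tau> q) = 1" "inj_on \<tau> (sphere 0 1)"
    "(\<forall>q. cmod q = 1 \<longrightarrow> disk_fun (T g - T f) q = a * disk_fun (g - f) (\<tau> q)) \<or>
     (\<forall>q. cmod q = 1 \<longrightarrow> disk_fun (T g - T f) q = a * cnj (disk_fun (g - f) (\<tau> q)))"
proof -
  obtain U where U: "U \<in> Iso" "T f = U f" "T g = U g"
    using assms unfolding two_local_in_Iso_def by blast
  define L where "L x = U x - U 0" for x
  have "L = (\<lambda>x. x - U 0) \<circ> U"
    by (simp add: L_def fun_eq_iff)
  then have "L \<in> Iso"
    using comp_in_Iso[OF diff_const_in_Iso U(1)] by metis
  moreover have "L 0 = 0"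
    by (simp add: L_def)
  ultimately obtain a \<tau> where a\<tau>: "cmod a = 1" "\<And>q. cmod q = 1 \<Longrightarrow> cmod (\<tau> q) = 1" "inj_on \<tau> (sphere 0 1)"
    and cases: "(\<forall>f q. cmod q = 1 \<longrightarrow> disk_fun (L f) q = a * disk_fun f (\<tau> q)) \<or>
     (\<forall>f q. cmod q = 1 \<longrightarrow> disk_fun (L f) q = a * cnj (disk_fun f (\<tau> q)))"
    by (rule Iso_form) blast
  have eq: "T g - T f = L g - L f"
    using U by (simp add: L_def)
  show thesis
    by (rule that[OF a\<tau>]) (use cases in \<open>auto simp: eq disk_fun_arith right_diff_distrib\<close>)
qed

text \<open>When |g - f| is constant on the circle, the unknown \<open>\<tau>\<close> of
  \<open>two_local_diff\<close> drops out.\<close>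

lemma two_local_cmod_diff:
  assumes T: "two_local_in_Iso (T :: disk_algebra \<Rightarrow> disk_algebra)"
    and r: "\<And>z. cmod z = 1 \<Longrightarrow> cmod (disk_fun g z - disk_fun f z) = r" and q: "cmod q = 1"
  shows "cmod (disk_fun (T g) q - disk_fun (T f) q) = r"
proof -
  obtain a \<tau> where "cmod a = 1" and \<tau>: "\<And>q. cmod q = 1 \<Longrightarrow> cmod (\<tau> q) = 1"
    and "(\<forall>q. cmod q = 1 \<longrightarrow> disk_fun (T g - T f) q = a * disk_fun (g - f) (\<tau> q)) \<or>
     (\<forall>q. cmod q = 1 \<longrightarrow> disk_fun (T g - T f) q = a * cnj (disk_fun (g - f) (\<tau> q)))"
    using two_local_diff[OF T, of g f] by metis
  then have "cmod (disk_fun (T g - T f) q) = cmod (disk_fun (g - f) (\<tau> q))"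
    using q by (auto simp: norm_mult)
  then show ?thesis
    using r[OF \<tau>[OF q]] by (simp add: disk_fun_arith)
qed

lemma dist_const_fun: "dist (const_fun c) (const_fun d) = cmod (c - d)"
proof -
  have "norm (const_fun c - const_fun d) \<le> cmod (c - d)"
    by (rule norm_disk_algebra_leI) (simp add: disk_fun_arith disk_fun_const)
  moreover have "cmod (c - d) \<le> norm (const_fun c - const_fun d)"
    using norm_disk_fun_le[of 0 "const_fun c - const_fun d"] by (simp add: disk_fun_arith disk_fun_const)
  ultimately show ?thesis
    by (simp add: dist_norm)
qed

lemma two_local_const:
  assumes T: "two_local_in_Iso T" "T 0 = 0"
  obtains d where "T (const_fun c) = const_fun d"
proof -
  obtain a \<tau> where "cmod a = 1" and \<tau>: "\<And>q. cmod q = 1 \<Longrightarrow> cmod (\<tau> q) = 1"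
    and *: "(\<forall>q. cmod q = 1 \<longrightarrow> disk_fun (T (const_fun c) - T 0) q = a * disk_fun (const_fun c - 0) (\<tau> q)) \<or>
     (\<forall>q. cmod q = 1 \<longrightarrow> disk_fun (T (const_fun c) - T 0) q = a * cnj (disk_fun (const_fun c - 0) (\<tau> q)))"
    using two_local_diff[OF T(1), of "const_fun c" 0] by metis
  from * show thesis
  proof
    assume *: "\<forall>q. cmod q = 1 \<longrightarrow> disk_fun (T (const_fun c) - T 0) q = a * disk_fun (const_fun c - 0) (\<tau> q)"
    have "T (const_fun c) = const_fun (a * c)"
      using * \<tau> T(2) by (intro eq_on_circleI) (simp add: disk_fun_const)
    then show thesis by (rule that)
  next
    assume *: "\<forall>q. cmod q = 1 \<longrightarrow> disk_fun (T (const_fun c) - T 0) q = a * cnj (disk_fun (const_fun c - 0) (\<tau> q))"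
    have "T (const_fun c) = const_fun (a * cnj c)"
      using * \<tau> T(2) by (intro eq_on_circleI) (simp add: disk_fun_const)
    then show thesis by (rule that)
  qed
qed

lemma complex_eq_if_dists:
  assumes "cmod d = cmod c" "cmod (d - 1) = cmod (c - 1)" "cmod (d - \<i>) = cmod (c - \<i>)"
  shows "d = c"
proof -
  have "(cmod d)\<^sup>2 = (cmod c)\<^sup>2" "(cmod (d - 1))\<^sup>2 = (cmod (c - 1))\<^sup>2" "(cmod (d - \<i>))\<^sup>2 = (cmod (c - \<i>))\<^sup>2"
    using assms by simp_all
  then show ?thesis
    unfolding cmod_power2 by (simp add: power2_diff complex_eq_iff)
qed

definition lin_fun :: "complex \<Rightarrow> disk_algebra"
  where "lin_fun c = disk_of (\<lambda>z. c * z)"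

lemma disk_fun_lin: "z \<in> cball 0 1 \<Longrightarrow> disk_fun (lin_fun c) z = c * z"
  unfolding lin_fun_def by (rule disk_fun_disk_of_entire) (auto intro!: holomorphic_intros)

lemma eq_minus_if_cmod_diff_2:
  assumes "cmod x = 1" "cmod y = 1" "cmod (x - y) = 2"
  shows "x = - y"
proof -
  have "(cmod (x + y))\<^sup>2 + (cmod (x - y))\<^sup>2 = 2 * (cmod x)\<^sup>2 + 2 * (cmod y)\<^sup>2"
    unfolding cmod_power2 by (simp add: power2_eq_square algebra_simps)
  then have "cmod (x + y) = 0"
    using assms by simp
  then show ?thesis
    by (simp add: add_eq_0_iff)
qed

lemma pm_ii_if_cmod_diff_sqrt2:
  assumes "cmod x = 1" "cmod (x - 1) = sqrt 2"
  shows "x = \<i> \<or> x = - \<i>"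
proof -
  have "(cmod x)\<^sup>2 = 1" "(cmod (x - 1))\<^sup>2 = 2"
    using assms by simp_all
  then have "(Re x)\<^sup>2 + (Im x)\<^sup>2 = 1" "(Re x - 1)\<^sup>2 + (Im x)\<^sup>2 = 2"
    unfolding cmod_power2 by simp_all
  moreover from this have "Re x = 0"
    by (simp add: power2_diff)
  ultimately have "Re x = 0" "(Im x)\<^sup>2 = 1"
    by simp_all
  then show ?thesis
    by (auto simp: complex_eq_iff power2_eq_1_iff)
qed

section \<open>2-local maps fixing 0, 1 and i\<close>

text \<open>Every 2-local map takes this form after a translation, a multiplication by a unimodular
  constant and possibly \<open>cnj_reflect\<close>. As 0, 1, i are not collinear, distances to them
  make every constant a fixed point.\<close>

locale normalized_two_local =
  fixes T :: "disk_algebra \<Rightarrow> disk_algebra"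
  assumes two_local: "two_local_in_Iso T"
    and T0: "T 0 = 0" and T1: "T (const_fun 1) = const_fun 1"
    and Ti: "T (const_fun \<i>) = const_fun \<i>"
begin

lemma T_const: "T (const_fun c) = const_fun c"
proof -
  obtain d where d: "T (const_fun c) = const_fun d"
    using two_local_const[OF two_local T0] .
  have "cmod (d - e) = cmod (c - e)" if "T (const_fun e) = const_fun e" for e
    using two_local_in_Iso_dist[OF two_local, of "const_fun c" "const_fun e"]
    by (simp add: d that dist_const_fun)
  from this[of 0] this[OF T1] this[OF Ti] have "d = c"
    by (intro complex_eq_if_dists) (simp_all add: const_fun_0 T0)
  with d show ?thesis by simp
qed

definition \<psi> :: "complex \<Rightarrow> complex"
  where "\<psi> = disk_fun (T (lin_fun 1))"

lemma cmod_T_lin: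
  assumes "cmod c = 1" "cmod q = 1"
  shows "cmod (disk_fun (T (lin_fun c)) q) = 1"
  using two_local_cmod_diff[OF two_local, of "lin_fun c" 0 1 q] assms
  by (simp add: T0 disk_fun_arith disk_fun_lin norm_mult)

lemma T_lin_diff:
  assumes "cmod q = 1"
  shows "cmod (disk_fun (T (lin_fun c)) q - disk_fun (T (lin_fun d)) q) = cmod (c - d)"
  by (rule two_local_cmod_diff[OF two_local _ assms])
    (simp add: disk_fun_lin norm_mult flip: left_diff_distrib)

lemma cmod_\<psi>: "cmod q = 1 \<Longrightarrow> cmod (\<psi> q) = 1"
  using cmod_T_lin[of 1] by (simp add: \<psi>_def)

text \<open>Comparison with \<open>T 0\<close> shows that on the circle \<open>\<psi>\<close> is
  \<open>a\<close> times \<open>\<tau>\<close> or its conjugate, for an injective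
  \<open>\<tau>\<close>.\<close>

lemma inj_\<psi>: "inj_on \<psi> (sphere 0 1)"
proof (rule inj_onI)
  fix q q' assume q: "q \<in> sphere 0 1" "q' \<in> sphere 0 1" "\<psi> q = \<psi> q'"
  obtain a \<tau> where a: "cmod a = 1" and \<tau>: "\<And>q. cmod q = 1 \<Longrightarrow> cmod (\<tau> q) = 1" and inj: "inj_on \<tau> (sphere 0 1)"
    and "(\<forall>q. cmod q = 1 \<longrightarrow> disk_fun (T (lin_fun 1) - T 0) q = a * disk_fun (lin_fun 1 - 0) (\<tau> q)) \<or>
     (\<forall>q. cmod q = 1 \<longrightarrow> disk_fun (T (lin_fun 1) - T 0) q = a * cnj (disk_fun (lin_fun 1 - 0) (\<tau> q)))"
    by (rule two_local_diff[OF two_local]) blast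
  moreover have "a \<noteq> 0" using a by auto
  moreover have "disk_fun (lin_fun 1) (\<tau> q) = \<tau> q" "disk_fun (lin_fun 1) (\<tau> q') = \<tau> q'"
    using \<tau> q by (simp_all add: disk_fun_lin)
  ultimately have "\<tau> q = \<tau> q'"
    using q by (auto simp: T0 \<psi>_def)
  then show "q = q'"
    by (rule inj_onD[OF inj _ q(1,2)])
qed

text \<open>The functions c z and -c z differ by 2 in modulus at every boundary point, and
  unimodular numbers at distance 2 are antipodal.\<close>

lemma T_lin_minus:
  assumes c: "cmod c = 1" and q: "cmod q = 1"
  shows "disk_fun (T (lin_fun (- c))) q = - disk_fun (T (lin_fun c)) q"
proof (rule eq_minus_if_cmod_diff_2)
  have "- c - c = - 2 * c" by simp
  then have "cmod (- c - c) = 2" using c by (simp add: norm_mult)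
  then show "cmod (disk_fun (T (lin_fun (- c))) q - disk_fun (T (lin_fun c)) q) = 2"
    using T_lin_diff[OF q] by simp
qed (use c q cmod_T_lin in auto)

text \<open>On the circle i z and z are everywhere sqrt 2 apart, so the quotient of their images is
  i or -i; continuity makes the sign uniform.\<close>

lemma T_lin_ii: "\<exists>s\<in>{\<i>, - \<i>}. \<forall>q. cmod q = 1 \<longrightarrow> disk_fun (T (lin_fun \<i>)) q = s * \<psi> q"
proof -
  let ?h = "\<lambda>q. disk_fun (T (lin_fun \<i>)) q / \<psi> q"
  have nz: "\<psi> q \<noteq> 0" if "cmod q = 1" for q
    using cmod_\<psi>[OF that] by auto
  have vals: "?h q \<in> {\<i>, - \<i>}" if "q \<in> sphere 0 1" for q
  proof -
    have q: "cmod q = 1" using that by simp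
    have "?h q - 1 = (disk_fun (T (lin_fun \<i>)) q - \<psi> q) / \<psi> q"
      using nz[OF q] by (simp add: field_simps)
    also have "cmod \<dots> = cmod (\<i> - 1)"
      using T_lin_diff[OF q, of \<i> 1] cmod_\<psi>[OF q] by (simp add: \<psi>_def norm_divide)
    also have "\<dots> = sqrt 2"
      by (simp add: cmod_def)
    finally show ?thesis
      using pm_ii_if_cmod_diff_sqrt2[of "?h q"] cmod_T_lin[of \<i> q] cmod_\<psi>[OF q] q
      by (simp add: norm_divide)
  qed
  have "continuous_on (sphere 0 1) ?h"
    using nz by (intro continuous_on_divide) (auto simp: \<psi>_def continuous_on_circle)
  from finite_range_constant[OF connected_unit_circle this _ vals]
  obtain s where s: "\<And>q. cmod q = 1 \<Longrightarrow> ?h q = s"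
    by auto
  show ?thesis
  proof (intro bexI[of _ s] allI impI)
    show "s \<in> {\<i>, - \<i>}"
      using vals[of 1] s[of 1] by simp
    show "disk_fun (T (lin_fun \<i>)) q = s * \<psi> q" if "cmod q = 1" for q
      using s[OF that] nz[OF that] by (simp add: field_simps)
  qed
qed

text \<open>Testing \<open>isometry_peak_functional\<close> with w = c p on the fixed constant w
  forces b = w. Testing it on \<open>lin_fun c\<close>, whose value at \<open>p\<close> is w, then
  determines the value of its image at \<open>q\<close>.\<close>

lemma T_functional:
  assumes c: "cmod c = 1" and p: "cmod p = 1"
  obtains q where "cmod q = 1" "disk_fun (T (lin_fun c)) q = c * p"
    "\<And>f. Re (cnj (c * p) * disk_fun f p) \<le> Re (cnj (c * p) * disk_fun (T f) q)"
proof -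
  define w where "w = c * p"
  have w: "cmod w = 1"
    using c p by (simp add: w_def norm_mult)
  obtain b q where b: "cmod b = 1" and q: "cmod q = 1"
    and le: "\<And>f. Re (cnj w * disk_fun f p) \<le> Re (cnj b * disk_fun (T f) q)"
    using isometry_peak_functional[of T w p] two_local_in_Iso_dist[OF two_local] T0 w p by metis
  have unit: "x = y" if "cmod x = 1" "cmod y = 1" "1 \<le> Re (cnj x * y)" for x y
  proof -
    have "cnj x * y = 1"
      using that by (intro eq_1_if_Re_ge_1) (simp_all add: norm_mult)
    then show ?thesis
      using cnj_mult_cancel(2)[OF that(1), of y] by simp
  qed
  have "Re (cnj w * w) \<le> Re (cnj b * w)"
    using le[of "const_fun w"] p q by (simp only: T_const disk_fun_const mem_cball dist_0_norm order_refl)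
  then have "b = w"
    using b w cnj_mult_self[OF w] by (intro unit) simp_all
  moreover have "w = disk_fun (T (lin_fun c)) q"
  proof (rule unit[OF w cmod_T_lin[OF c q]])
    have "cnj w * disk_fun (lin_fun c) p = 1"
      using p cnj_mult_self[OF w] by (simp add: disk_fun_lin w_def)
    then show "1 \<le> Re (cnj w * disk_fun (T (lin_fun c)) q)"
      using le[of "lin_fun c"] \<open>b = w\<close> by simp
  qed
  ultimately show thesis
    using that[OF q] le by (simp add: w_def)
qed

text \<open>The choice of \<open>p\<close> gives c p = s \<psi>(q), so injectivity of
  \<open>\<psi>\<close> identifies the point from \<open>T_functional\<close> with \<open>q\<close>.
  Replacing c by -c keeps both points and reverses the inequality.\<close>

lemma T_Re:
  assumes c: "cmod c = 1" and s: "cmod s = 1" and q: "cmod q = 1"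
    and Tc: "\<And>q. cmod q = 1 \<Longrightarrow> disk_fun (T (lin_fun c)) q = s * \<psi> q"
  defines "p \<equiv> cnj c * s * \<psi> q"
  shows "Re (cnj (s * \<psi> q) * disk_fun f p) = Re (cnj (s * \<psi> q) * disk_fun (T f) q)"
proof -
  have p: "cmod p = 1"
    using c s cmod_\<psi>[OF q] by (simp add: p_def norm_mult)
  have cp: "c * p = s * \<psi> q"
    using c by (simp add: p_def cnj_mult_cancel mult.assoc)
  have s0: "s \<noteq> 0" using s by auto
  have inj: "q' = q" if "cmod q' = 1" "s * \<psi> q' = s * \<psi> q" for q'
    using inj_onD[OF inj_\<psi>, of q' q] that q s0 by simp
  have "Re (cnj (s * \<psi> q) * disk_fun f p) \<le> Re (cnj (s * \<psi> q) * disk_fun (T f) q)"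
  proof -
    obtain q' where q': "cmod q' = 1" "disk_fun (T (lin_fun c)) q' = c * p"
      and le: "\<And>f. Re (cnj (c * p) * disk_fun f p) \<le> Re (cnj (c * p) * disk_fun (T f) q')"
      using T_functional[OF c p] by metis
    have "s * \<psi> q' = s * \<psi> q"
      using q' Tc[OF q'(1)] by (simp add: cp)
    then have "q' = q"
      by (rule inj[OF q'(1)])
    then show ?thesis
      using le[of f] unfolding cp by simp
  qed
  moreover have "- Re (cnj (s * \<psi> q) * disk_fun f p) \<le> - Re (cnj (s * \<psi> q) * disk_fun (T f) q)"
  proof -
    have c': "cmod (- c) = 1" using c by simp
    obtain q' where q': "cmod q' = 1" "disk_fun (T (lin_fun (- c))) q' = - c * p"
      and le: "\<And>f. Re (cnj (- c * p) * disk_fun f p) \<le> Re (cnj (- c * p) * disk_fun (T f) q')"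
      using T_functional[OF c' p] by metis
    have "s * \<psi> q' = s * \<psi> q"
      using q' Tc[OF q'(1)] T_lin_minus[OF c q'(1)] by (simp add: cp)
    then have "q' = q"
      by (rule inj[OF q'(1)])
    moreover have "- c * p = - (s * \<psi> q)"
      by (simp add: cp)
    ultimately show ?thesis
      using le[of f] by (simp del: times_complex.sel complex_cnj_mult)
  qed
  ultimately show ?thesis by simp
qed

lemma T_Re_1:
  assumes "cmod q = 1"
  shows "Re (cnj (\<psi> q) * disk_fun f (\<psi> q)) = Re (cnj (\<psi> q) * disk_fun (T f) q)"
  using T_Re[of 1 1 q f] assms by (simp add: \<psi>_def)

text \<open>Under the sign -i, the real part of cnj (\<psi> q) (T f)(q) depends on f at \<psi> q,
  its imaginary part on f at -\<psi> q. An odd power z^k would go to cnj(\<psi>)^(k-2) on the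
  circle; k = 3 is the first contradictory case.\<close>

lemma T_lin_ii_eq:
  assumes q: "cmod q = 1"
  shows "disk_fun (T (lin_fun \<i>)) q = \<i> * \<psi> q"
proof (rule ccontr)
  assume "disk_fun (T (lin_fun \<i>)) q \<noteq> \<i> * \<psi> q"
  with T_lin_ii q have neg: "disk_fun (T (lin_fun \<i>)) q = - \<i> * \<psi> q" if "cmod q = 1" for q
    using that by auto
  \<comment> \<open>In this case \<open>T f\<close> would have the boundary values \<open>cnj (\<psi> q)\<close>, so \<open>\<psi>\<close> would be invertible.\<close>
  define f where "f = disk_of (\<lambda>z. z ^ 3)"
  have f: "disk_fun f z = z ^ 3" if "cmod z = 1" for z
    unfolding f_def using that by (intro disk_fun_disk_of_entire) (auto intro!: holomorphic_intros)
  have "T f * T (lin_fun 1) = 1"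
  proof (rule eq_on_circleI)
    fix q assume q: "cmod q = 1"
    define P where "P = \<psi> q"
    define y where "y = cnj P * disk_fun (T f) q"
    have P: "cmod P = 1"
      using cmod_\<psi>[OF q] by (simp add: P_def)
    have P3: "cnj P * P ^ 3 = P\<^sup>2"
      using P by (simp add: power3_eq_cube power2_eq_square cnj_mult_cancel mult.assoc)
    have "Re y = Re (P\<^sup>2)"
      using T_Re_1[OF q, of f] f[OF P] P3 unfolding y_def P_def[symmetric] by metis
    moreover have "Im y = - Im (P\<^sup>2)"
    proof -
      \<comment> \<open>This is the point \<open>p\<close> of \<open>T_Re\<close> for
        \<open>c = \<i>\<close> and \<open>s = - \<i>\<close>; oddness of z^3 then flips the sign of
        the imaginary part.\<close>
      have "cnj \<i> * (- \<i>) * P = - P"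
        by simp
      then have "Re (cnj (- \<i> * P) * disk_fun f (- P)) = Re (cnj (- \<i> * P) * disk_fun (T f) q)"
        using T_Re[of \<i> "- \<i>" q f, OF _ _ q neg] unfolding P_def[symmetric] by simp
      also have "disk_fun f (- P) = - (P ^ 3)"
        using f[of "- P"] P by simp
      also have "cnj (- \<i> * P) * - (P ^ 3) = - \<i> * P\<^sup>2"
        unfolding P3[symmetric] by simp
      also have "cnj (- \<i> * P) * disk_fun (T f) q = \<i> * y"
        by (simp add: y_def)
      finally show ?thesis
        by simp
    qed
    ultimately have "y = cnj (P\<^sup>2)"
      by (simp add: complex_eq_iff del: complex_cnj_power)
    then have "P * y = cnj P"
      using P by (simp add: power2_eq_square cnj_mult_cancel)
    then have "disk_fun (T f) q = cnj P"
      using P by (simp add: y_def cnj_mult_cancel)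
    then show "disk_fun (T f * T (lin_fun 1)) q = disk_fun 1 q"
      using q cnj_mult_self[OF P] by (simp add: disk_fun_arith disk_fun_1 P_def \<psi>_def)
  qed
  have "\<psi> z \<noteq> 0" if "z \<in> cball 0 1" for z
    using arg_cong[OF \<open>T f * T (lin_fun 1) = 1\<close>, of "\<lambda>h. disk_fun h z"] that
    by (auto simp: disk_fun_arith disk_fun_1 \<psi>_def)
  then obtain a where "\<forall>z\<in>cball 0 1. \<psi> z = a"
    using unimodular_nonvanishing_const[of "T (lin_fun 1)"] cmod_\<psi> unfolding \<psi>_def by blast
  then show False
    using inj_onD[OF inj_\<psi>, of 1 "- 1"] by simp
qed

text \<open>For \<open>c = s = \<i>\<close> the point in \<open>T_Re\<close> is again \<psi> q,
  which supplies the imaginary part missing from \<open>T_Re_1\<close>.\<close>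

lemma T_eq_comp_\<psi>:
  assumes q: "cmod q = 1"
  shows "disk_fun (T f) q = disk_fun f (\<psi> q)"
proof -
  have "Re (cnj (\<i> * \<psi> q) * disk_fun f (\<psi> q)) = Re (cnj (\<i> * \<psi> q) * disk_fun (T f) q)"
    using T_Re[of \<i> \<i> q f, OF _ _ q T_lin_ii_eq] by simp
  then have "Im (cnj (\<psi> q) * disk_fun f (\<psi> q)) = Im (cnj (\<psi> q) * disk_fun (T f) q)"
    by (simp add: algebra_simps)
  with T_Re_1[OF q, of f] have "cnj (\<psi> q) * disk_fun f (\<psi> q) = cnj (\<psi> q) * disk_fun (T f) q"
    by (simp only: complex_eq_iff)
  then show ?thesis
    using cmod_\<psi>[OF q] by auto
qed

text \<open>A preimage of \<open>g\<close> must solve f o \<psi> = g on the circle. An isometry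
  \<open>L\<close> agreeing with \<open>T\<close> at 0 and z expresses \<open>\<psi>\<close> through
  its own \<open>\<tau>\<close>, and surjectivity of \<open>L\<close> solves the equation up to
  rotation and reflection.\<close>

lemma surj_T: "surj T"
proof (rule surjI)
  fix g
  obtain L where L: "L \<in> Iso" "L 0 = 0" "L (lin_fun 1) = T (lin_fun 1)"
    using two_local T0 unfolding two_local_in_Iso_def by metis
  obtain a \<tau> where a: "cmod a = 1" and \<tau>: "\<And>q. cmod q = 1 \<Longrightarrow> cmod (\<tau> q) = 1"
    and cases: "(\<forall>f q. cmod q = 1 \<longrightarrow> disk_fun (L f) q = a * disk_fun f (\<tau> q)) \<or>
     (\<forall>f q. cmod q = 1 \<longrightarrow> disk_fun (L f) q = a * cnj (disk_fun f (\<tau> q)))"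
    using Iso_form[OF L(1,2)] by metis
  have a0: "a \<noteq> 0" using a by auto
  have a': "cmod (cnj a) = 1" using a by simp
  \<comment> \<open>The factor \<open>a\<close> cancels the one in the form of \<open>L\<close>, so
    that \<open>g\<close> equals h o \<tau> or its conjugate on the circle.\<close>
  obtain h where h: "L h = const_fun a * g"
    using IsoD(2)[OF L(1)] by (metis surjD)
  have Lh: "disk_fun (L h) q = a * disk_fun g q" if "cmod q = 1" for q
    using that by (simp add: h disk_fun_arith disk_fun_const)
  have id: "disk_fun (lin_fun 1) (\<tau> q) = \<tau> q" if "cmod q = 1" for q
    using \<tau>[OF that] by (simp add: disk_fun_lin)
  from cases have "\<exists>f. T f = g"
  proof
    assume *: "\<forall>f q. cmod q = 1 \<longrightarrow> disk_fun (L f) q = a * disk_fun f (\<tau> q)"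
    have "T (disk_of (\<lambda>w. disk_fun h (cnj a * w))) = g"
    proof (rule eq_on_circleI)
      fix q assume q: "cmod q = 1"
      have "\<psi> q = a * \<tau> q"
        using *[rule_format, OF q, of "lin_fun 1"] L(3) id[OF q] by (simp add: \<psi>_def)
      moreover have "disk_fun h (\<tau> q) = disk_fun g q"
        using * q Lh[OF q] a0 by simp
      ultimately show "disk_fun (T (disk_of (\<lambda>w. disk_fun h (cnj a * w)))) q = disk_fun g q"
        using a cmod_\<psi>[OF q] unfolding T_eq_comp_\<psi>[OF q]
        by (subst disk_fun_rotate[OF a']) (simp_all add: cnj_mult_cancel)
    qed
    then show ?thesis by blast
  next
    assume *: "\<forall>f q. cmod q = 1 \<longrightarrow> disk_fun (L f) q = a * cnj (disk_fun f (\<tau> q))"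
    have "T (disk_of (\<lambda>w. disk_fun (cnj_reflect h) (cnj a * w))) = g"
    proof (rule eq_on_circleI)
      fix q assume q: "cmod q = 1"
      have "\<psi> q = a * cnj (\<tau> q)"
        using *[rule_format, OF q, of "lin_fun 1"] L(3) id[OF q] by (simp add: \<psi>_def)
      moreover have "cnj (disk_fun h (\<tau> q)) = disk_fun g q"
        using * q Lh[OF q] a0 by simp
      ultimately show "disk_fun (T (disk_of (\<lambda>w. disk_fun (cnj_reflect h) (cnj a * w)))) q = disk_fun g q"
        using a \<tau>[OF q] cmod_\<psi>[OF q] unfolding T_eq_comp_\<psi>[OF q]
        by (subst disk_fun_rotate[OF a']) (simp_all add: cnj_mult_cancel disk_fun_cnj_reflect)
    qed
    then show ?thesis by blast
  qed
  then show "T (SOME f. T f = g) = g"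
    by (rule someI_ex)
qed

lemma T_in_Iso: "T \<in> Iso"
  using surj_T two_local_in_Iso_dist[OF two_local] by (simp add: Iso_def)

end

section \<open>Reduction to the normalized case\<close>

theorem corollary12:
  fixes T :: "disk_algebra \<Rightarrow> disk_algebra"
  assumes "two_local_in_Iso T"
  shows "T \<in> Iso"
proof -
  define U1 where "U1 = (\<lambda>f. f - T 0)"
  define T1 where "T1 = U1 \<circ> T"
  have U1: "U1 \<in> Iso"
    unfolding U1_def by (rule diff_const_in_Iso)
  have T1: "two_local_in_Iso T1" "T1 0 = 0"
    using two_local_in_Iso_comp[OF U1 assms] by (simp_all add: T1_def U1_def)
  obtain a where a: "T1 (const_fun 1) = const_fun a"
    using two_local_const[OF T1] .
  have "cmod a = 1"
    using two_local_in_Iso_dist[OF T1(1), of "const_fun 1" "const_fun 0"]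
    unfolding a dist_const_fun const_fun_0 T1(2) by (simp add: const_fun_0[symmetric] dist_const_fun)
  then have a': "cmod (cnj a) = 1" by simp
  \<comment> \<open>Multiplication by the conjugate of the unimodular constant \<open>a\<close>
    makes 1 a fixed point.\<close>
  define U2 where "U2 = (\<lambda>f. const_fun (cnj a) * f)"
  define T2 where "T2 = U2 \<circ> T1"
  have U2: "U2 \<in> Iso"
    unfolding U2_def by (rule mult_const_in_Iso[OF a'])
  have T2: "two_local_in_Iso T2" "T2 0 = 0"
    using two_local_in_Iso_comp[OF U2 T1(1)] T1(2) by (simp_all add: T2_def U2_def)
  have T21: "T2 (const_fun 1) = const_fun 1"
    by (rule disk_algebra_eqI)
      (simp add: T2_def U2_def a disk_fun_arith disk_fun_const cnj_mult_self[OF \<open>cmod a = 1\<close>])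
  obtain d where d: "T2 (const_fun \<i>) = const_fun d"
    using two_local_const[OF T2] .
  have "cmod d = 1"
    using two_local_in_Iso_dist[OF T2(1), of "const_fun \<i>" "const_fun 0"]
    unfolding d dist_const_fun const_fun_0 T2(2) by (simp add: const_fun_0[symmetric] dist_const_fun)
  \<comment> \<open>The distances to 0 and 1 leave only i and -i as image of i.\<close>
  moreover have "cmod (d - 1) = sqrt 2"
    using two_local_in_Iso_dist[OF T2(1), of "const_fun \<i>" "const_fun 1"]
    unfolding d dist_const_fun T21 by (simp add: cmod_def)
  ultimately have "d = \<i> \<or> d = - \<i>"
    by (rule pm_ii_if_cmod_diff_sqrt2)
  then have "T2 \<in> Iso"
  proof
    assume "d = \<i>"
    then interpret normalized_two_local T2
      using T2 T21 d by unfold_locales simp_all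
    show ?thesis by (rule T_in_Iso)
  next
    assume d': "d = - \<i>"
    have R: "cnj_reflect (const_fun c) = const_fun (cnj c)" for c
      by (rule disk_algebra_eqI) (simp add: disk_fun_cnj_reflect disk_fun_const)
    \<comment> \<open>The reflection fixes 0 and 1 and sends -i to i.\<close>
    interpret normalized_two_local "cnj_reflect \<circ> T2"
      using two_local_in_Iso_comp[OF cnj_reflect_in_Iso T2(1)] T2(2) T21 d d' R[of 0]
      by unfold_locales (simp_all add: R const_fun_0)
    show ?thesis
      by (rule Iso_comp_cancel[OF cnj_reflect_in_Iso T_in_Iso])
  qed
  then have "T1 \<in> Iso"
    unfolding T2_def by (rule Iso_comp_cancel[OF U2])
  then show ?thesis
    unfolding T1_def by (rule Iso_comp_cancel[OF U1])
qed

end
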